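(* For all complex $a$, $b$, $x$ and $z\neq0$ with $1+a\notin\{0,-1,-2,\dots\}$ for which the series on the left and the integral on the right (along the straight segment from $0$ to $z$) converge, $$\sum _{n=0}^{\infty } \frac{(1+a)_n \, {}_2F_1\left(-n,1+a+b+n;1+a;\frac{1-x}{2}\right) z^n}{(n+1)!}=\int_0^z \frac{2^{a+b} \left(1-s+\sqrt{1+s^2-2 s x}\right)^{-a} \left(1+s+\sqrt{1+s^2-2 s x}\right)^{-b}}{z\,\sqrt{1+s^2-2 s x}} \, ds .$$
   Context: ${}_2F_1$ is the Gauss hypergeometric function (a polynomial here) and $(c)_n=c(c+1)\cdots(c+n-1)$, $(c)_0=1$, is the Pochhammer symbol. Powers and square roots are principal values.
   Formalization: It is also assumed that the square root and the two bases 1-s+√(1+s²-2sx), 1+s+√(1+s²-2sx) vanish at only finitely many points of the segment; this excludes only x=-1, b a negative integer, Re z<-1, where the identity fails (e.g. a=0, b=-1, x=-1, z=-2: 1 against 1/2). *)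

theory Defs
  imports "HOL-Complex_Analysis.Complex_Analysis"
begin

(* The argument 1 of fps_hypergeo is the scaling factor of the variable, so that
   eval_fps (fps_hypergeo ..) is evaluation of the usual Gauss series; see hyp2F1_eq. *)
definition hyp2F1 :: "complex \<Rightarrow> complex \<Rightarrow> complex \<Rightarrow> complex \<Rightarrow> complex" where
  "hyp2F1 a b c w = eval_fps (fps_hypergeo [a, b] [c] 1) w"

lemma hyp2F1_eq:
  "hyp2F1 a b c w = (\<Sum>k. pochhammer a k * pochhammer b k / (pochhammer c k * fact k) * w ^ k)"
  by (simp add: hyp2F1_def eval_fps_def)

definition jacobi_term :: "complex \<Rightarrow> complex \<Rightarrow> complex \<Rightarrow> complex \<Rightarrow> nat \<Rightarrow> complex" where
  "jacobi_term a b x z n =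
     pochhammer (1 + a) n * hyp2F1 (- of_nat n) (1 + a + b + of_nat n) (1 + a) ((1 - x) / 2) * z ^ n
       / fact (n + 1)"

definition jacobi_root :: "complex \<Rightarrow> complex \<Rightarrow> complex" where
  "jacobi_root x s = csqrt (1 + s ^ 2 - 2 * s * x)"

definition jacobi_integrand ::
    "complex \<Rightarrow> complex \<Rightarrow> complex \<Rightarrow> complex \<Rightarrow> complex \<Rightarrow> complex" where
  "jacobi_integrand a b x z s =
     2 powr (a + b) * (1 - s + jacobi_root x s) powr (- a) * (1 + s + jacobi_root x s) powr (- b)
       / (z * jacobi_root x s)"

(* The points s at which the integrand has no meaning: the principal power
   w powr c = exp (c * Ln w) needs w \<noteq> 0 and the denominator must not vanish.
   (The library's totalised 0 powr c = 0 and u / 0 = 0 would otherwise assign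
   spurious values to the integrand there.) *)
definition jacobi_undefined :: "complex \<Rightarrow> complex set" where
  "jacobi_undefined x =
     {s. jacobi_root x s = 0 \<or> 1 - s + jacobi_root x s = 0 \<or> 1 + s + jacobi_root x s = 0}"

end

theory Submission
  imports Defs
begin

text \<open>
  Write \<open>P n\<close> for the Jacobi polynomial with parameters \<open>a\<close>, \<open>b\<close> at \<open>x\<close>, so that the series of the
  theorem is the sum of \<open>P n / (n + 1) * z ^ n\<close>. Up to the factor \<open>1 / z\<close> it is the termwise integral
  of \<open>P n * s ^ n\<close> along the segment, and the integrand is Jacobi's closed form of that
  generating series. Two things have to be shown: the closed form, and that it represents the
  sum of the series, with principal branches, on the whole open segment.

  The closed form comes from Lagrange inversion. With \<open>y = (1 - x) / 2\<close>, the number \<open>P n\<close> is the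
  coefficient of \<open>u ^ n\<close> in \<open>\<psi> u * \<phi> u ^ n\<close>, where \<open>\<phi> u = (1 + u) / (1 + u * y)\<close> and
  \<open>\<psi> u = (1 + u) powr a * (1 + u * y) powr (- (a + b + 1))\<close> (\<open>jacobi_poly_conv_deriv\<close>). Hence
  the series is obtained by evaluating at the small root \<open>w0\<close> of
  \<open>w = s * \<phi> w\<close> (\<open>lagrange_series\<close>). This equation is quadratic in \<open>w\<close> with discriminant
  \<open>1 + s^2 - 2 * s * x\<close>, which is where the square root \<open>R\<close> of the integrand comes from. The result
  is \<open>jacobi_genfun_near_0\<close>, for small \<open>s\<close>.

  The radicand factors as \<open>(1 - s * t) * (1 - s / t)\<close> with \<open>norm t \<le> 1\<close>. If \<open>norm s < norm t\<close>, both
  factors have positive real part, so their product avoids the branch cut of the square root; and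
  \<open>1 - s + R\<close> and \<open>1 + s + R\<close> have positive real part. Thus the closed form is holomorphic
  on the disc of radius \<open>norm t\<close>, and there it is the sum of the series.

  If \<open>z\<close> lies in the closure of this disc, so does the segment, and only its endpoint can
  leave the open disc. Otherwise the series converges beyond the branch point \<open>t\<close>. For
  \<open>x \<noteq> 1\<close>, \<open>x \<noteq> - 1\<close> this is impossible, since the closed form is unbounded at \<open>t\<close>. For
  \<open>x = 1\<close> the series is that of \<open>(1 - s) powr (- a - 1)\<close>, and the condition on \<open>1 + a\<close> makes its
  radius \<open>1\<close>. What remains is \<open>x = - 1\<close> with \<open>- b - 1\<close> a natural number, where
  the series is a polynomial (\<open>jacobi_series_beyond_branch_point\<close>); then the finiteness of the
  set of undefined points keeps the open segment inside the half-plane \<open>Re (1 + s) > 0\<close>, in which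
  the closed form equals that polynomial.

  Finally, the series may converge only conditionally at \<open>z\<close>, so the endpoint is reached by Abel's
  limit theorem (\<open>abel_limit\<close>) together with the fundamental theorem of calculus in the form that
  asks for the derivative only in the interior of the interval.
\<close>

section \<open>Jacobi polynomials as Taylor coefficients\<close>

definition jacobi_poly :: "complex \<Rightarrow> complex \<Rightarrow> complex \<Rightarrow> nat \<Rightarrow> complex" where
  "jacobi_poly a b x n =
     pochhammer (1 + a) n / fact n
       * hyp2F1 (- of_nat n) (1 + a + b + of_nat n) (1 + a) ((1 - x) / 2)"

definition jacobi_genfun :: "complex \<Rightarrow> complex \<Rightarrow> complex \<Rightarrow> complex \<Rightarrow> complex" where
  "jacobi_genfun a b x s =
     2 powr (a + b) * (1 - s + jacobi_root x s) powr (- a) * (1 + s + jacobi_root x s) powr (- b)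
       / jacobi_root x s"

lemma jacobi_term_conv_poly:
  "jacobi_term a b x z n = jacobi_poly a b x n / of_nat (Suc n) * z ^ n"
  by (simp add: jacobi_term_def jacobi_poly_def del: of_nat_Suc)

lemma jacobi_integrand_conv_genfun: "jacobi_integrand a b x z s = jacobi_genfun a b x s / z"
  by (simp add: jacobi_integrand_def jacobi_genfun_def)

text \<open>
  This form of the Gauss polynomial is a Cauchy product of two binomial series, which exhibits
  \<open>P n\<close> as a Taylor coefficient. The two sums agree term by term; the condition on
  \<open>1 + a\<close> allows cancelling the Pochhammer symbols in the denominators.
\<close>

lemma jacobi_poly_conv_gbinomial:
  assumes "1 + a \<notin> \<int>\<^sub>\<le>\<^sub>0"
  shows "jacobi_poly a b x n =
    (\<Sum>m\<le>n. ((a + of_nat n) gchoose (n - m)) *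
       ((- (a + b + 1 + of_nat n) gchoose m) * ((1 - x) / 2) ^ m))"
proof -
  define y where "y = (1 - x) / 2"
  define c where "c = a + b + 1 + of_nat n"
  have nz: "pochhammer (1 + a) m \<noteq> 0" for m
    using assms by (auto simp: pochhammer_eq_0_iff)
  have "hyp2F1 (- of_nat n) c (1 + a) y =
      (\<Sum>k\<le>n. pochhammer (- of_nat n) k * pochhammer c k / (pochhammer (1 + a) k * fact k) * y ^ k)"
    unfolding hyp2F1_eq by (rule suminf_finite) (auto simp: pochhammer_of_nat_eq_0_lemma)
  then have "jacobi_poly a b x n = (\<Sum>k\<le>n. pochhammer (1 + a) n / fact n *
      (pochhammer (- of_nat n) k * pochhammer c k / (pochhammer (1 + a) k * fact k) * y ^ k))"
    by (simp add: jacobi_poly_def c_def y_def add_ac sum_distrib_left)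
  also have "\<dots> = (\<Sum>m\<le>n. ((a + of_nat n) gchoose (n - m)) * ((- c gchoose m) * y ^ m))"
  proof (rule sum.cong[OF refl], goal_cases)
    case (1 m)
    then have m: "m \<le> n" by simp
    have 1: "pochhammer (1 + a) n = pochhammer (1 + a) m * pochhammer (1 + a + of_nat m) (n - m)"
      using m by (rule pochhammer_product)
    have 2: "(a + of_nat n) gchoose (n - m) = pochhammer (1 + a + of_nat m) (n - m) / fact (n - m)"
      using m by (simp add: gbinomial_pochhammer' of_nat_diff add_ac)
    have 3: "- c gchoose m = (-1) ^ m * pochhammer c m / fact m"
      by (simp add: gbinomial_pochhammer)
    have "fact n / (fact m * fact (n - m)) = (of_nat n gchoose m :: complex)"
      using m by (simp add: binomial_fact flip: binomial_gbinomial)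
    also have "\<dots> = (-1) ^ m * pochhammer (- of_nat n) m / fact m"
      by (rule gbinomial_pochhammer)
    finally have 4: "(-1) ^ m * pochhammer (- of_nat n) m = (fact n / fact (n - m) :: complex)"
      by (simp add: field_simps)
    have 5: "pochhammer (- of_nat n) m = ((-1) ^ m * (fact n / fact (n - m)) :: complex)"
      unfolding 4[symmetric] by (simp flip: power_mult_distrib mult.assoc)
    show ?case
      unfolding 1 2 3 5 using nz[of m] by (simp add: field_simps)
  qed
  finally show ?thesis by (simp add: c_def y_def)
qed

lemma binomial_scaled_has_fps_expansion:
  fixes c y :: complex
  shows "(\<lambda>u. (1 + u * y) powr c) has_fps_expansion Abs_fps (\<lambda>n. (c gchoose n) * y ^ n)"
proof (rule has_fps_expansionI)
  have "((\<lambda>u. norm (u * y)) \<longlongrightarrow> norm (0 * y)) (nhds 0)"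
    by (intro tendsto_intros filterlim_ident)
  then have "eventually (\<lambda>u. norm (u * y) < 1) (nhds 0)"
    by (rule order_tendstoD) simp
  then show "\<forall>\<^sub>F u in nhds 0. (\<lambda>n. fps_nth (Abs_fps (\<lambda>n. (c gchoose n) * y ^ n)) n * u ^ n)
      sums (1 + u * y) powr c"
  proof eventually_elim
    case (elim u)
    show ?case
      using gen_binomial_complex[OF elim, of c] by (simp add: power_mult_distrib mult_ac)
  qed
qed

text \<open>
  The exponents depend on \<open>n\<close> only through an \<open>n\<close>-th power of a fixed function, which is the
  shape that Lagrange inversion needs.
\<close>

lemma jacobi_poly_conv_deriv:
  assumes "1 + a \<notin> \<int>\<^sub>\<le>\<^sub>0"
  shows "jacobi_poly a b x n = (deriv ^^ n) (\<lambda>u. (1 + u) powr (a + of_nat n) *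
     (1 + u * ((1 - x) / 2)) powr (- (a + b + 1 + of_nat n))) 0 / fact n"
proof -
  have "(\<lambda>u. (1 + u * ((1 - x) / 2)) powr (- (a + b + 1 + of_nat n)) *
       (1 + u) powr (a + of_nat n)) has_fps_expansion
     Abs_fps (\<lambda>m. (- (a + b + 1 + of_nat n) gchoose m) * ((1 - x) / 2) ^ m) *
       fps_binomial (a + of_nat n)"
    by (intro has_fps_expansion_mult has_fps_expansion_binomial_complex
              binomial_scaled_has_fps_expansion)
  from fps_nth_fps_expansion[OF this, of n, symmetric] show ?thesis
    unfolding jacobi_poly_conv_gbinomial[OF assms] fps_mult_nth
    by (simp add: atLeast0AtMost mult.commute)
qed

section \<open>Lagrange inversion\<close>

text \<open>
  By Cauchy's formula the \<open>n\<close>-th coefficient is the integral of \<open>\<psi> u * \<phi> u ^ n / u ^ (n + 1)\<close> over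
  a circle. On the circle \<open>norm (s * \<phi> u / u) \<le> q < 1\<close>, so the geometric series may be summed under
  the integral and gives \<open>\<psi> u / (u - s * \<phi> u)\<close>, whose only pole inside is \<open>w0\<close>. The hypothesis
  \<open>root\<close> names the cofactor \<open>h\<close> explicitly. This replaces an argument counting the zeros of
  \<open>w - s * \<phi> w\<close>; as \<open>h w0 = 1 - s * deriv \<phi> w0\<close>, the value is Lagrange's classical one.
\<close>

lemma lagrange_series:
  fixes \<phi> \<psi> h :: "complex \<Rightarrow> complex"
  assumes r: "0 < r" and w0: "norm w0 < r" and q: "0 \<le> q" "q < 1"
    and hol: "\<phi> holomorphic_on cball 0 r" "\<psi> holomorphic_on cball 0 r" "h holomorphic_on cball 0 r"
    and small: "\<And>w. norm w = r \<Longrightarrow> norm (s * \<phi> w) \<le> q * r"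
    and root: "\<And>w. w \<in> cball 0 r \<Longrightarrow> w - s * \<phi> w = (w - w0) * h w"
    and nz: "\<And>w. w \<in> cball 0 r \<Longrightarrow> h w \<noteq> 0"
  shows "(\<lambda>n. (deriv ^^ n) (\<lambda>u. \<psi> u * \<phi> u ^ n) 0 / fact n * s ^ n) sums (\<psi> w0 / h w0)"
proof -
  define c where "c = (\<lambda>n. (deriv ^^ n) (\<lambda>u. \<psi> u * \<phi> u ^ n) 0 / fact n)"
  define K where "K = (\<lambda>u. (\<psi> u / h u) / (u - w0))"
  have K: "(K has_contour_integral (2 * of_real pi * \<i> * (\<psi> w0 / h w0))) (circlepath 0 r)"
    unfolding K_def using w0 nz
    by (intro Cauchy_integral_circlepath_simple holomorphic_intros hol) auto
  have c: "((\<lambda>u. \<psi> u * \<phi> u ^ n / u ^ Suc n * s ^ n)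
      has_contour_integral (2 * of_real pi * \<i> * (c n * s ^ n))) (circlepath 0 r)" for n
  proof -
    have h: "(\<lambda>u. \<psi> u * \<phi> u ^ n) holomorphic_on cball 0 r"
      by (intro holomorphic_intros hol)
    have "((\<lambda>u. \<psi> u * \<phi> u ^ n / (u - 0) ^ Suc n) has_contour_integral
        (2 * pi * \<i> / fact n * (deriv ^^ n) (\<lambda>u. \<psi> u * \<phi> u ^ n) 0)) (circlepath 0 r)"
      using h r by (intro Cauchy_has_contour_integral_higher_derivative_circlepath
          holomorphic_on_imp_continuous_on) (auto intro: holomorphic_on_subset)
    from has_contour_integral_rmul[OF this, of "s ^ n"] show ?thesis
      by (simp add: c_def mult_ac)
  qed
  have "continuous_on (sphere 0 r) K"
    unfolding K_def using w0 nz
    by (intro continuous_intros holomorphic_on_imp_continuous_on holomorphic_on_subset[OF hol(2)]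
        holomorphic_on_subset[OF hol(3)]) auto
  then have "bounded (K ` sphere 0 r)"
    by (intro compact_imp_bounded compact_continuous_image) auto
  then obtain B where B: "B > 0" "\<And>u. norm u = r \<Longrightarrow> norm (K u) \<le> B"
    unfolding bounded_pos by auto
  have bound: "norm (\<psi> w0 / h w0 - (\<Sum>n<N. c n * s ^ n)) \<le> B * r * q ^ N" for N
  proof -
    have "((\<lambda>u. K u - (\<Sum>n<N. \<psi> u * \<phi> u ^ n / u ^ Suc n * s ^ n)) has_contour_integral
       (2 * of_real pi * \<i> * (\<psi> w0 / h w0) - (\<Sum>n<N. 2 * of_real pi * \<i> * (c n * s ^ n))))
       (circlepath 0 r)"
      by (intro has_contour_integral_diff has_contour_integral_sum K c) auto
    then have "norm (2 * of_real pi * \<i> * (\<psi> w0 / h w0) - (\<Sum>n<N. 2 * of_real pi * \<i> * (c n * s ^ n)))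
        \<le> (B * q ^ N) * (2 * pi * r)"
    proof (rule has_contour_integral_bound_circlepath)
      show "0 \<le> B * q ^ N" using B q by simp
      show "0 < r" by fact
      fix u :: complex assume "norm (u - 0) = r"
      then have u: "norm u = r" "u \<noteq> 0" "u \<in> cball 0 r" "u \<noteq> w0" using r w0 by auto
      define v where "v = s * \<phi> u / u"
      have v: "norm v \<le> q"
        using small[OF u(1)] u r by (simp add: v_def norm_divide field_simps)
      have v1: "1 - v \<noteq> 0" using v q by auto
      have Ku: "K u = \<psi> u / u / (1 - v)"
      proof -
        \<comment> \<open>Thus \<open>K\<close> is the sum of the full geometric series, and subtracting a partial sum leaves a
            remainder with ratio at most \<open>q\<close>.\<close>
        have "u * (1 - v) = u - s * \<phi> u"
          using u(2) by (simp add: v_def right_diff_distrib)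
        then have "u * (1 - v) = (u - w0) * h u"
          using root[OF u(3)] by simp
        then show ?thesis by (simp add: K_def field_simps)
      qed
      have "(\<Sum>n<N. \<psi> u * \<phi> u ^ n / u ^ Suc n * s ^ n) = \<psi> u / u * (\<Sum>n<N. v ^ n)"
        by (simp add: v_def sum_distrib_left power_mult_distrib power_divide field_simps)
      also have "(\<Sum>n<N. v ^ n) = (1 - v ^ N) / (1 - v)"
        using v1 by (subst sum_gp_strict) auto
      also have "K u - \<psi> u / u * ((1 - v ^ N) / (1 - v)) = K u * v ^ N"
        unfolding Ku by (simp add: algebra_simps diff_divide_distrib)
      finally show "norm (K u - (\<Sum>n<N. \<psi> u * \<phi> u ^ n / u ^ Suc n * s ^ n)) \<le> B * q ^ N"
        using v B u q by (auto simp: norm_mult norm_power intro!: mult_mono power_mono)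
    qed
    also have "2 * of_real pi * \<i> * (\<psi> w0 / h w0) - (\<Sum>n<N. 2 * of_real pi * \<i> * (c n * s ^ n))
        = 2 * of_real pi * \<i> * (\<psi> w0 / h w0 - (\<Sum>n<N. c n * s ^ n))"
      by (simp add: right_diff_distrib sum_distrib_left)
    finally have "2 * pi * norm (\<psi> w0 / h w0 - (\<Sum>n<N. c n * s ^ n)) \<le> 2 * pi * (B * r * q ^ N)"
      by (simp only: norm_mult) (simp add: mult_ac)
    then show ?thesis by (rule mult_left_le_imp_le) simp
  qed
  have "(\<lambda>N. B * r * q ^ N) \<longlonglongrightarrow> 0"
    using q by (intro tendsto_mult_right_zero LIMSEQ_power_zero) simp
  with always_eventually[OF allI[OF bound]]
  have "(\<lambda>N. \<psi> w0 / h w0 - (\<Sum>n<N. c n * s ^ n)) \<longlonglongrightarrow> 0"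
    by (rule Lim_null_comparison)
  then have "(\<lambda>N. \<psi> w0 / h w0 - (\<psi> w0 / h w0 - (\<Sum>n<N. c n * s ^ n))) \<longlonglongrightarrow> \<psi> w0 / h w0 - 0"
    by (intro tendsto_intros)
  then show ?thesis by (simp add: sums_def c_def)
qed

section \<open>The generating function near the origin\<close>

text \<open>In the right half-plane arguments are smaller than \<open>pi / 2\<close>, so the difference of the two
  logarithms is again a principal value.\<close>

lemma powr_divide_right_halfplane:
  fixes u v c :: complex
  assumes "0 < Re u" "0 < Re v"
  shows "(u / v) powr c = u powr c * v powr (- c)"
proof -
  have nz: "u \<noteq> 0" "v \<noteq> 0" using assms by auto
  have "\<bar>Im (Ln u)\<bar> < pi / 2" "\<bar>Im (Ln v)\<bar> < pi / 2"
    using assms nz Re_Ln_pos_lt by blast+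
  then have "Ln (u / v) = Ln u - Ln v"
    using nz by (intro Ln_unique) (auto simp: exp_diff)
  then have "c * Ln (u / v) = c * Ln u + (- c) * Ln v"
    by (simp only: right_diff_distrib) simp
  then show ?thesis
    using nz by (simp only: powr_def exp_add divide_eq_0_iff) simp
qed

lemma jacobi_root_square: "jacobi_root x s ^ 2 = 1 + s ^ 2 - 2 * s * x"
  by (simp add: jacobi_root_def)

lemma Re_jacobi_root_nonneg: "0 \<le> Re (jacobi_root x s)"
  unfolding jacobi_root_def by (rule Re_csqrt)

lemma Re_one_plus_minus_jacobi_root_pos:
  assumes "norm s < 1"
  shows "0 < Re (1 - s + jacobi_root x s)" "0 < Re (1 + s + jacobi_root x s)"
  using assms Re_jacobi_root_nonneg[of x s] abs_Re_le_cmod[of s] by auto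

text \<open>
  Lagrange inversion with the \<open>\<phi>\<close> and \<open>\<psi>\<close> read off from \<open>jacobi_poly_conv_deriv\<close>. Clearing the
  denominator, \<open>w = s * \<phi> w\<close> becomes \<open>y * w^2 + (1 - s) * w - s = 0\<close>. The form
  \<open>2 * s / (1 - s + R)\<close> of its root is the one that tends to \<open>0\<close> with \<open>s\<close> and stays valid for
  \<open>y = 0\<close>. The bound on \<open>s\<close> is not sharp: it only has to leave room for a circle on which
  \<open>\<phi>\<close> is bounded by \<open>2\<close> and inside which \<open>w0\<close> is the only root.
\<close>

lemma jacobi_genfun_near_0:
  assumes a: "1 + a \<notin> \<int>\<^sub>\<le>\<^sub>0" and s: "norm s * (16 * (1 + norm ((1 - x) / 2))) \<le> 1"
  shows "(\<lambda>n. jacobi_poly a b x n * s ^ n) sums jacobi_genfun a b x s"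
proof -
  define y where "y = (1 - x) / 2"
  define R where "R = jacobi_root x s"
  define r where "r = 1 / (4 * (1 + norm y))"
  define w0 where "w0 = 2 * s / (1 - s + R)"
  define \<phi> where "\<phi> = (\<lambda>u. (1 + u) / (1 + u * y))"
  define \<psi> where "\<psi> = (\<lambda>u. (1 + u) powr a * (1 + u * y) powr (- (a + b + 1)))"
  define h where "h = (\<lambda>u. (y * u + y * w0 + (1 - s)) / (1 + u * y))"
  have y1: "0 < 1 + norm y" by (smt (verit) norm_ge_zero)
  have r: "0 < r" "r \<le> 1 / 4" "r * norm y \<le> 1 / 4"
    using y1 by (simp_all add: r_def field_simps)
  have sr: "norm s \<le> r / 4"
    using s y1 by (simp add: r_def y_def[symmetric] field_simps)
  have s1: "norm s < 1" using sr r by simp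
  have Re: "0 < Re (1 - s + R)" "0 < Re (1 + s + R)"
    unfolding R_def using Re_one_plus_minus_jacobi_root_pos[OF s1] by auto
  have D: "3 / 4 \<le> norm (1 - s + R)"
    using complex_Re_le_cmod[of "1 - s + R"] Re_jacobi_root_nonneg[of x s]
      complex_Re_le_cmod[of s] sr r by (auto simp: R_def)
  have w0: "norm w0 < r"
  proof -
    have "norm w0 \<le> 2 * norm s / (3 / 4)"
      unfolding w0_def norm_divide norm_mult using D by (intro frac_le) auto
    also have "\<dots> < r" using sr r by simp
    finally show ?thesis .
  qed
  have in_disc: "norm u \<le> 1 / 4 \<and> norm (u * y) \<le> 1 / 4" if "u \<in> cball 0 r" for u
    using that r mult_right_mono[of "norm u" r "norm y"] by (auto simp: norm_mult)
  have Re_pos: "0 < Re (1 + u)" if "norm u \<le> 1 / 4" for u :: complex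
    using that abs_Re_le_cmod[of u] by simp
  have halfplane: "1 + u \<notin> \<real>\<^sub>\<le>\<^sub>0" if "norm u \<le> 1 / 4" for u :: complex
    using Re_pos[OF that] by (auto simp: complex_nonpos_Reals_iff)
  have nz: "1 + u \<noteq> 0" if "norm u \<le> 1 / 4" for u :: complex
    using halfplane[OF that] by auto
  have D0: "1 - s + R \<noteq> 0" using D by auto
  have "R ^ 2 = 1 + s ^ 2 - 2 * s * x" by (simp add: R_def jacobi_root_square)
  moreover have "y * (4 * s) = 2 * s * (1 - x)" by (simp add: y_def)
  ultimately have "y * (4 * s) = (R - (1 - s)) * (1 - s + R)"
    by algebra
  then have yw0: "y * w0 = (R - (1 - s)) / 2"
    using D0 by (simp add: w0_def field_simps)
  have w0_eq: "w0 * (1 - s + R) = 2 * s" using D0 by (simp add: w0_def)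
  have quad: "y * w0 ^ 2 + (1 - s) * w0 - s = 0"
  proof -
    have "2 * (y * w0 ^ 2 + (1 - s) * w0 - s) = w0 * (2 * (y * w0)) + 2 * (1 - s) * w0 - 2 * s"
      by (simp add: power2_eq_square algebra_simps)
    also have "2 * (y * w0) = R - (1 - s)" by (simp add: yw0)
    also have "w0 * (R - (1 - s)) + 2 * (1 - s) * w0 - 2 * s = w0 * (1 - s + R) - 2 * s"
      by (simp add: algebra_simps)
    finally have "2 * (y * w0 ^ 2 + (1 - s) * w0 - s) = 0" unfolding w0_eq by simp
    then show ?thesis by (simp only: mult_eq_0_iff) simp
  qed
  have "(\<lambda>n. (deriv ^^ n) (\<lambda>u. \<psi> u * \<phi> u ^ n) 0 / fact n * s ^ n) sums (\<psi> w0 / h w0)"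
  proof (rule lagrange_series[where r = r and q = "1 / 2"])
    show "\<phi> holomorphic_on cball 0 r" "\<psi> holomorphic_on cball 0 r" "h holomorphic_on cball 0 r"
      unfolding \<phi>_def \<psi>_def h_def
      by (intro holomorphic_intros; use in_disc nz halfplane in blast)+
    show "norm (s * \<phi> w) \<le> 1 / 2 * r" if "norm w = r" for w
    proof -
      have w: "norm w \<le> 1 / 4" "norm (w * y) \<le> 1 / 4" using in_disc[of w] that by auto
      have "norm (1 + w) \<le> 5 / 4" using norm_triangle_ineq[of 1 w] w by simp
      moreover have "3 / 4 \<le> norm (1 + w * y)"
        using norm_triangle_ineq4[of "1 + w * y" "w * y"] w by simp
      ultimately have "norm (\<phi> w) \<le> (5 / 4) / (3 / 4)"
        unfolding \<phi>_def norm_divide by (intro frac_le) auto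
      then have "norm s * norm (\<phi> w) \<le> r / 4 * 2" using sr r by (intro mult_mono) auto
      then show ?thesis by (simp add: norm_mult)
    qed
    show "w - s * \<phi> w = (w - w0) * h w" if "w \<in> cball 0 r" for w
    proof -
      have n: "1 + w * y \<noteq> 0" using nz in_disc that by blast
      have "(w - w0) * (y * w + y * w0 + (1 - s)) =
          w * (1 + w * y) - s * (1 + w) - (y * w0 ^ 2 + (1 - s) * w0 - s)"
        by (simp add: algebra_simps power2_eq_square)
      then show ?thesis unfolding quad h_def \<phi>_def using n by (simp add: field_simps)
    qed
    show "h w \<noteq> 0" if "w \<in> cball 0 r" for w
    proof -
      have n: "1 + w * y \<noteq> 0" using nz in_disc that by blast
      have "norm (y * w) \<le> 1 / 4" "norm (y * w0) \<le> 1 / 4"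
        using in_disc[of w] in_disc[of w0] that w0 by (auto simp: mult.commute)
      moreover have "norm s \<le> 1 / 16" using sr r by simp
      ultimately have "norm (y * w + y * w0 - s) < 1"
        using norm_triangle_ineq4[of "y * w + y * w0" s] norm_triangle_ineq[of "y * w" "y * w0"]
        by linarith
      then have "1 + (y * w + y * w0 - s) \<noteq> 0"
        by (metis add_eq_0_iff less_irrefl norm_minus_cancel norm_one)
      then show ?thesis using n by (simp add: h_def algebra_simps)
    qed
  qed (use r w0 in auto)
  also have "(\<lambda>n. (deriv ^^ n) (\<lambda>u. \<psi> u * \<phi> u ^ n) 0 / fact n * s ^ n) =
      (\<lambda>n. jacobi_poly a b x n * s ^ n)"
  proof
    fix n
    have "eventually (\<lambda>u. u \<in> ball 0 r) (nhds 0)"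
      using r by (intro eventually_nhds_in_open) auto
    then have "\<forall>\<^sub>F u in nhds 0. \<psi> u * \<phi> u ^ n =
        (1 + u) powr (a + of_nat n) * (1 + u * y) powr (- (a + b + 1 + of_nat n))"
    proof eventually_elim
      case (elim u)
      then have "1 + u \<noteq> 0" "1 + u * y \<noteq> 0" using in_disc[of u] nz by auto
      moreover have "(1 + u * y) powr (- (a + b + 1 + of_nat n)) =
          (1 + u * y) powr (- (a + b + 1)) * (1 + u * y) powr (- of_nat n)"
        by (simp flip: powr_add)
      ultimately show ?case
        by (simp add: \<psi>_def \<phi>_def powr_add powr_minus powr_nat power_divide field_simps)
    qed
    then have "(deriv ^^ n) (\<lambda>u. \<psi> u * \<phi> u ^ n) 0 = (deriv ^^ n) (\<lambda>u. (1 + u) powr (a + of_nat n) *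
        (1 + u * y) powr (- (a + b + 1 + of_nat n))) 0"
      by (intro higher_deriv_cong_ev) auto
    then show "(deriv ^^ n) (\<lambda>u. \<psi> u * \<phi> u ^ n) 0 / fact n * s ^ n = jacobi_poly a b x n * s ^ n"
      using jacobi_poly_conv_deriv[OF a, of b x n] by (simp add: y_def)
  qed
  also have "\<psi> w0 / h w0 = jacobi_genfun a b x s"
  proof -
    \<comment> \<open>All quantities at \<open>w0\<close> are expressible by \<open>A\<close>, \<open>B\<close> and \<open>R\<close>, and both \<open>A\<close> and \<open>B\<close> lie in the
        right half-plane, so the principal powers may be recombined.\<close>
    define A where "A = 1 + s + R"
    define B where "B = 1 - s + R"
    have AB: "0 < Re A" "0 < Re B" using Re by (simp_all add: A_def B_def)
    have nzAB: "A \<noteq> 0" "B \<noteq> 0" using AB by auto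
    have "1 + w0 = A / B" using D0 by (simp add: w0_def A_def B_def field_simps)
    moreover have "1 + w0 * y = A / 2"
      using yw0 by (simp add: A_def field_simps)
    moreover have "y * w0 + y * w0 + (1 - s) = R" unfolding yw0 by simp
    moreover have "\<psi> w0 / h w0 = (1 + w0) powr a * (1 + w0 * y) powr (- (a + b + 1)) *
        (1 + w0 * y) / (y * w0 + y * w0 + (1 - s))"
      by (simp add: \<psi>_def h_def)
    ultimately have "\<psi> w0 / h w0 = (A / B) powr a * (A / 2) powr (- (a + b + 1)) * (A / 2) / R"
      by (simp only:)
    also have "\<dots> = (A powr a * A powr (- (a + b + 1)) * A) * B powr (- a) * (2 powr (a + b + 1) / 2) / R"
      using powr_divide_right_halfplane[OF AB, of a]
        powr_divide_right_halfplane[of A 2 "- (a + b + 1)"] AB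
      by (simp only: minus_minus) simp
    also have "A powr a * A powr (- (a + b + 1)) * A = A powr (- b)"
    proof -
      have "A powr a * A powr (- (a + b + 1)) * A powr 1 = A powr (a + - (a + b + 1) + 1)"
        by (simp only: powr_add)
      also have "a + - (a + b + 1) + 1 = - b" by simp
      also have "A powr 1 = A" using nzAB by (simp add: powr_def)
      finally show ?thesis .
    qed
    also have "2 powr (a + b + 1) / 2 = (2 powr (a + b) :: complex)"
      by (simp add: powr_add)
    finally show ?thesis
      by (simp add: jacobi_genfun_def A_def B_def R_def mult_ac)
  qed
  finally show ?thesis .
qed

section \<open>Abel's limit theorem\<close>

text \<open>
  With \<open>B n\<close> the tail of the series after its \<open>n\<close>-th term, summation by parts writes the power
  series at \<open>u\<close> as the full sum minus \<open>(1 - u)\<close> times the power series of \<open>B\<close>. As \<open>B\<close> tends to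
  \<open>0\<close>, all but finitely many of its terms together contribute at most \<open>e / 2\<close> times
  \<open>1 / (1 - u)\<close>, and the factor \<open>1 - u\<close> removes the rest in the limit.
\<close>

lemma abel_limit:
  fixes a :: "nat \<Rightarrow> complex"
  assumes "summable a"
  shows "((\<lambda>u::real. \<Sum>n. a n * of_real u ^ n) \<longlongrightarrow> suminf a) (at_left 1)"
proof -
  define B where "B = (\<lambda>n. suminf a - (\<Sum>k<Suc n. a k))"
  have B0: "B \<longlonglongrightarrow> 0"
    using summable_LIMSEQ[OF assms] unfolding B_def
    by (intro tendsto_eq_intros LIMSEQ_Suc) auto
  then have "Bseq B" by (rule convergent_imp_Bseq[OF convergentI])
  then obtain K where K: "K > 0" "\<And>n. norm (B n) \<le> K" unfolding Bseq_def by auto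
  have summable: "summable (\<lambda>n. norm (B n * of_real u ^ n))" if "0 \<le> u" "u < 1" for u :: real
  proof (rule summable_comparison_test')
    show "summable (\<lambda>n. K * u ^ n)" using that by (intro summable_mult summable_geometric) auto
    show "norm (norm (B n * of_real u ^ n)) \<le> K * u ^ n" if "n \<ge> 0" for n
      using K(2)[of n] \<open>0 \<le> u\<close> by (simp add: norm_mult norm_power mult_right_mono)
  qed
  have eq: "(\<Sum>n. a n * of_real u ^ n) = suminf a - of_real (1 - u) * (\<Sum>n. B n * of_real u ^ n)"
    if "0 \<le> u" "u < 1" for u :: real
  proof -
    have s: "(\<lambda>n. B n * of_real u ^ n) sums (\<Sum>n. B n * of_real u ^ n)"
      using summable_norm_cancel[OF summable[OF that]] by (rule summable_sums)
    have s': "(\<lambda>n. B (Suc n) * of_real u ^ Suc n) sums ((\<Sum>n. B n * of_real u ^ n) - B 0)"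
      using s by (subst sums_Suc_iff) simp
    have "(\<lambda>n. of_real u * (B n * of_real u ^ n) - B (Suc n) * of_real u ^ Suc n) sums
       (of_real u * (\<Sum>n. B n * of_real u ^ n) - ((\<Sum>n. B n * of_real u ^ n) - B 0))"
      by (intro sums_diff sums_mult s s')
    also have "(\<lambda>n. of_real u * (B n * of_real u ^ n) - B (Suc n) * of_real u ^ Suc n) =
        (\<lambda>n. a (Suc n) * of_real u ^ Suc n)"
      by (simp add: B_def fun_eq_iff algebra_simps)
    finally have "(\<lambda>n. a n * of_real u ^ n) sums
       (of_real u * (\<Sum>n. B n * of_real u ^ n) - ((\<Sum>n. B n * of_real u ^ n) - B 0) + a 0)"
      by (subst (asm) sums_Suc_iff) simp
    then show ?thesis by (simp add: sums_iff B_def algebra_simps)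
  qed
  have "((\<lambda>u::real. of_real (1 - u) * (\<Sum>n. B n * of_real u ^ n)) \<longlongrightarrow> 0) (at_left 1)"
  proof (rule tendstoI)
    fix e :: real assume e: "e > 0"
    obtain N where N: "\<And>n. n \<ge> N \<Longrightarrow> norm (B n) < e / 2"
      using LIMSEQ_D[OF B0, of "e / 2"] e by auto
    have "((\<lambda>u::real. (1 - u) * (\<Sum>n<N. norm (B n))) \<longlongrightarrow> (1 - 1) * (\<Sum>n<N. norm (B n))) (at_left 1)"
      by (intro tendsto_intros)
    then have ev: "\<forall>\<^sub>F u in at_left 1. (1 - u) * (\<Sum>n<N. norm (B n)) < e / 2"
      by (rule order_tendstoD) (use e in simp)
    have "\<forall>\<^sub>F u in at_left (1::real). u \<in> {0<..<1}" by (intro eventually_at_left_real) auto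
    with ev show "\<forall>\<^sub>F u in at_left (1::real). dist (of_real (1 - u) * (\<Sum>n. B n * of_real u ^ n)) 0 < e"
    proof eventually_elim
      case (elim u)
      then have u: "0 \<le> u" "u < 1" by auto
      have geo: "summable (\<lambda>n. u ^ n)" using u by (intro summable_geometric) auto
      have "norm (\<Sum>n. B n * of_real u ^ n) \<le> (\<Sum>n. norm (B n * of_real u ^ n))"
        by (intro summable_norm summable u)
      also have "\<dots> = (\<Sum>n. norm (B (n + N) * of_real u ^ (n + N))) + (\<Sum>n<N. norm (B n * of_real u ^ n))"
        by (rule suminf_split_initial_segment[OF summable[OF u]])
      also have "(\<Sum>n. norm (B (n + N) * of_real u ^ (n + N))) \<le> (\<Sum>n. e / 2 * u ^ n)"
      proof (rule suminf_le)
        show "norm (B (n + N) * of_real u ^ (n + N)) \<le> e / 2 * u ^ n" for n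
        proof -
          have "u ^ (n + N) \<le> u ^ n" using u by (intro power_decreasing) auto
          then have "norm (B (n + N)) * u ^ (n + N) \<le> e / 2 * u ^ n"
            using N[of "n + N"] u e by (intro mult_mono) auto
          then show ?thesis
            using u by (simp add: norm_mult norm_power)
        qed
        show "summable (\<lambda>n. norm (B (n + N) * of_real u ^ (n + N)))"
          using summable[OF u] by (rule summable_ignore_initial_segment)
        show "summable (\<lambda>n. e / 2 * u ^ n)" by (intro summable_mult geo)
      qed
      also have "(\<Sum>n. e / 2 * u ^ n) = e / 2 / (1 - u)"
        using u by (subst suminf_mult[OF geo]) (simp add: suminf_geometric)
      also have "(\<Sum>n<N. norm (B n * of_real u ^ n)) \<le> (\<Sum>n<N. norm (B n))"
        using u by (intro sum_mono) (auto simp: norm_mult norm_power mult_left_le power_le_one)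
      finally have "(1 - u) * norm (\<Sum>n. B n * of_real u ^ n) \<le> (1 - u) * (e / 2 / (1 - u) + (\<Sum>n<N. norm (B n)))"
        using u by (intro mult_left_mono) auto
      also have "\<dots> = e / 2 + (1 - u) * (\<Sum>n<N. norm (B n))"
        using u by (simp add: field_simps)
      also have "\<dots> < e" using elim by simp
      finally show ?case
        using u by (simp add: norm_mult del: of_real_diff)
    qed
  qed
  then have "((\<lambda>u::real. suminf a - of_real (1 - u) * (\<Sum>n. B n * of_real u ^ n)) \<longlongrightarrow> suminf a - 0) (at_left 1)"
    by (intro tendsto_intros)
  moreover have "\<forall>\<^sub>F u in at_left (1::real). u \<in> {0<..<1}" by (intro eventually_at_left_real) auto
  then have "\<forall>\<^sub>F u in at_left (1::real). suminf a - of_real (1 - u) * (\<Sum>n. B n * of_real u ^ n) =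
      (\<Sum>n. a n * of_real u ^ n)"
    by eventually_elim (simp add: eq del: of_real_diff)
  ultimately show ?thesis by (simp add: tendsto_cong)
qed

section \<open>The disc of convergence\<close>

text \<open>The roots of the radicand \<open>1 + t^2 - 2 * t * x\<close> have product \<open>1\<close>, so one of them lies in the
  closed unit disc.\<close>

lemma jacobi_branch_point:
  obtains t where "t \<noteq> 0" "norm t \<le> 1" "1 + t ^ 2 = 2 * t * (x :: complex)"
proof -
  define d where "d = csqrt (x ^ 2 - 1)"
  have d: "d ^ 2 = x ^ 2 - 1" by (simp add: d_def)
  then have prod: "(x + d) * (x - d) = 1" by algebra
  have root: "1 + (x + d) ^ 2 = 2 * (x + d) * x" "1 + (x - d) ^ 2 = 2 * (x - d) * x"
    using d by algebra+
  have "norm (x + d) * norm (x - d) = 1" using prod by (metis norm_mult norm_one)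
  then have "norm (x + d) \<le> 1 \<or> norm (x - d) \<le> 1"
    by (smt (verit) mult_le_cancel_left1 norm_ge_zero)
  moreover have "x + d \<noteq> 0" "x - d \<noteq> 0" using prod by auto
  ultimately show thesis using root that by blast
qed

text \<open>
  The radicand is \<open>u * v\<close> for \<open>u = 1 - s * t\<close> and \<open>v = 1 - s / t\<close>, both of positive real
  part. If \<open>u * v = - c\<close> with \<open>c \<ge> 0\<close>, then \<open>v\<close> would be a nonpositive multiple of the
  conjugate of \<open>u\<close>, and its real part could not be positive.
\<close>

lemma jacobi_radicand_notin_nonpos_Reals:
  fixes x s t :: complex
  assumes t: "t \<noteq> 0" "norm t \<le> 1" "1 + t ^ 2 = 2 * t * x" and s: "norm s < norm t"
  shows "1 + s ^ 2 - 2 * s * x \<notin> \<real>\<^sub>\<le>\<^sub>0"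
proof
  assume "1 + s ^ 2 - 2 * s * x \<in> \<real>\<^sub>\<le>\<^sub>0"
  then obtain c where c: "1 + s ^ 2 - 2 * s * x = - of_real c" "c \<ge> 0"
    by (auto elim!: nonpos_Reals_cases intro: that[of "- r" for r])
  define u v where "u = 1 - s * t" and "v = 1 - s / t"
  have pos: "0 < Re (1 - w)" if "norm w < 1" for w :: complex
    using that complex_Re_le_cmod[of w] by simp
  have "norm (s * t) < 1 * 1"
    unfolding norm_mult using s t by (intro mult_less_le_imp_less) auto
  then have u: "0 < Re u" unfolding u_def by (intro pos) simp
  have v: "0 < Re v" unfolding v_def using s t by (intro pos) (simp add: norm_divide)
  have "t * (u * v) = t * (1 + s ^ 2) - s * (1 + t ^ 2)"
    using t(1) by (simp add: u_def v_def field_simps power2_eq_square)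
  also have "\<dots> = t * (1 + s ^ 2 - 2 * s * x)" unfolding t(3) by (simp add: algebra_simps)
  also have "\<dots> = t * - of_real c" by (simp only: c)
  finally have uv: "u * v = - of_real c" using t(1) by (simp only: mult_cancel_left) simp
  have "of_real ((norm u)\<^sup>2) * v = cnj u * (u * v)"
    by (simp add: complex_norm_square mult_ac del: of_real_power)
  also have "\<dots> = - of_real c * cnj u" unfolding uv by simp
  finally have "Re (of_real ((norm u)\<^sup>2) * v) = Re (- of_real c * cnj u)" by simp
  then have "(norm u)\<^sup>2 * Re v = - c * Re u" by simp
  moreover have "0 < (norm u)\<^sup>2 * Re v" using u v by (intro mult_pos_pos) auto
  moreover have "0 \<le> c * Re u" using c u by simp
  ultimately show False by simp
qed

lemma jacobi_genfun_holomorphic: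
  assumes t: "t \<noteq> 0" "norm t \<le> 1" "1 + t ^ 2 = 2 * t * x"
  shows "jacobi_genfun a b x holomorphic_on ball 0 (norm t)"
proof -
  have n: "1 + s ^ 2 - 2 * s * x \<notin> \<real>\<^sub>\<le>\<^sub>0" if "s \<in> ball 0 (norm t)" for s
    using jacobi_radicand_notin_nonpos_Reals[OF t] that by simp
  have R: "jacobi_root x holomorphic_on ball 0 (norm t)"
    unfolding jacobi_root_def by (intro holomorphic_intros n)
  have R0: "jacobi_root x s \<noteq> 0" if "s \<in> ball 0 (norm t)" for s
    using n[OF that] by (auto simp: jacobi_root_def)
  have AB: "1 - s + jacobi_root x s \<notin> \<real>\<^sub>\<le>\<^sub>0 \<and> 1 + s + jacobi_root x s \<notin> \<real>\<^sub>\<le>\<^sub>0"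
    if "s \<in> ball 0 (norm t)" for s
  proof -
    have "norm s < 1" using that t(2) by simp
    from Re_one_plus_minus_jacobi_root_pos[OF this, of x] show ?thesis
      by (auto simp: complex_nonpos_Reals_iff)
  qed
  show ?thesis unfolding jacobi_genfun_def
    by (intro holomorphic_intros R) (use R0 AB in auto)
qed

lemma jacobi_genfun_has_fps_expansion:
  assumes "1 + a \<notin> \<int>\<^sub>\<le>\<^sub>0"
  shows "jacobi_genfun a b x has_fps_expansion Abs_fps (jacobi_poly a b x)"
proof (rule has_fps_expansionI)
  have "((\<lambda>s. norm s * (16 * (1 + norm ((1 - x) / 2)))) \<longlongrightarrow> norm (0::complex) * (16 * (1 + norm ((1 - x) / 2)))) (nhds (0::complex))"
    by (intro tendsto_mult_right tendsto_norm[OF filterlim_ident])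
  then have "\<forall>\<^sub>F s in nhds (0::complex). norm s * (16 * (1 + norm ((1 - x) / 2))) < 1"
    by (rule order_tendstoD) simp
  then show "\<forall>\<^sub>F s in nhds 0. (\<lambda>n. fps_nth (Abs_fps (jacobi_poly a b x)) n * s ^ n) sums jacobi_genfun a b x s"
    by eventually_elim (use jacobi_genfun_near_0[OF assms] in simp)
qed

lemma eval_jacobi_poly_series:
  assumes a: "1 + a \<notin> \<int>\<^sub>\<le>\<^sub>0" and t: "t \<noteq> 0" "norm t \<le> 1" "1 + t ^ 2 = 2 * t * x"
    and s: "norm s < norm t"
  shows "eval_fps (Abs_fps (jacobi_poly a b x)) s = jacobi_genfun a b x s"
  using jacobi_genfun_has_fps_expansion[OF a] s jacobi_genfun_holomorphic[OF t]
  by (rule has_fps_expansion_imp_eval_fps_eq)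

lemma jacobi_root_minus_one:
  assumes "0 < Re (1 + s)"
  shows "jacobi_root (- 1) s = 1 + s"
  unfolding jacobi_root_def using assms
  by (intro csqrt_unique) (auto simp: power2_eq_square algebra_simps)

lemma jacobi_genfun_minus_one:
  assumes "0 < Re (1 + s)"
  shows "jacobi_genfun a b (- 1) s = (1 + s) powr (- b - 1)"
proof -
  have nz: "1 + s \<noteq> 0" using assms by (metis less_irrefl zero_complex.sel(1))
  have "(1 + s + (1 + s)) = (1 + s) / (1 / 2)" by simp
  also have "\<dots> powr (- b) = (1 + s) powr (- b) * (1 / 2) powr b"
    using assms by (subst powr_divide_right_halfplane) auto
  also have "(1 / 2) powr b = (2 powr (- b) :: complex)"
    using powr_divide_right_halfplane[of 1 2 b] by simp
  finally have A: "(1 + s + (1 + s)) powr (- b) = (1 + s) powr (- b) * 2 powr (- b)" .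
  have "2 powr (a + b) * 2 powr (- a) * 2 powr (- b) = (1 :: complex)"
    by (simp flip: powr_add)
  then have "jacobi_genfun a b (- 1) s = (1 + s) powr (- b) / (1 + s)"
    unfolding jacobi_genfun_def jacobi_root_minus_one[OF assms] A
    by (simp add: mult_ac)
  also have "\<dots> = (1 + s) powr (- b - 1)"
    using nz by (simp add: powr_diff)
  finally show ?thesis .
qed

text \<open>On coefficients this is the classical symmetry of the Jacobi polynomials under exchange of
  \<open>a\<close> and \<open>b\<close>; it reduces \<open>x = 1\<close> to \<open>x = - 1\<close>.\<close>

lemma jacobi_genfun_reflect: "jacobi_genfun a b x s = jacobi_genfun b a (- x) (- s)"
  by (simp add: jacobi_genfun_def jacobi_root_def add_ac mult_ac)

lemma jacobi_series_minus_one: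
  assumes "1 + a \<notin> \<int>\<^sub>\<le>\<^sub>0"
  shows "Abs_fps (jacobi_poly a b (- 1)) = fps_binomial (- b - 1)"
proof (rule fps_expansion_unique_complex)
  show "jacobi_genfun a b (- 1) has_fps_expansion Abs_fps (jacobi_poly a b (- 1))"
    by (rule jacobi_genfun_has_fps_expansion) fact
  have "\<forall>\<^sub>F s in nhds 0. s \<in> ball (0::complex) 1" by (intro eventually_nhds_in_open) auto
  then have "\<forall>\<^sub>F s in nhds 0. (1 + s) powr (- b - 1) = jacobi_genfun a b (- 1) s"
  proof eventually_elim
    case (elim s)
    then show ?case using abs_Re_le_cmod[of s] by (subst jacobi_genfun_minus_one) auto
  qed
  then show "jacobi_genfun a b (- 1) has_fps_expansion fps_binomial (- b - 1)"
    using has_fps_expansion_binomial_complex[of "- b - 1"] by (subst (asm) has_fps_expansion_cong) auto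
qed

lemma jacobi_series_one:
  assumes "1 + a \<notin> \<int>\<^sub>\<le>\<^sub>0"
  shows "Abs_fps (jacobi_poly a b 1) = Abs_fps (\<lambda>n. (- a - 1 gchoose n) * (- 1) ^ n)"
proof (rule fps_expansion_unique_complex)
  show "jacobi_genfun a b 1 has_fps_expansion Abs_fps (jacobi_poly a b 1)"
    by (rule jacobi_genfun_has_fps_expansion) fact
  have "\<forall>\<^sub>F s in nhds 0. s \<in> ball (0::complex) 1" by (intro eventually_nhds_in_open) auto
  then have "\<forall>\<^sub>F s in nhds 0. (1 + s * (- 1)) powr (- a - 1) = jacobi_genfun a b 1 s"
  proof eventually_elim
    case (elim s)
    then show ?case
      using abs_Re_le_cmod[of s] by (subst jacobi_genfun_reflect, subst jacobi_genfun_minus_one) auto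
  qed
  then show "jacobi_genfun a b 1 has_fps_expansion Abs_fps (\<lambda>n. (- a - 1 gchoose n) * (- 1) ^ n)"
    using binomial_scaled_has_fps_expansion[of "- 1" "- a - 1"]
    by (subst (asm) has_fps_expansion_cong) auto
qed

text \<open>
  If the radius exceeds \<open>norm t\<close>, the sum \<open>F\<close> of the series is continuous at \<open>t\<close>, and \<open>F * R\<close>
  tends to \<open>0\<close> as \<open>s\<close> approaches \<open>t\<close> radially. But \<open>F * R\<close> is the numerator of the closed form,
  which at \<open>t\<close> tends to a nonzero value unless \<open>t\<close> is \<open>1\<close> or \<open>- 1\<close>, that is, unless \<open>x\<close>
  is. In these two cases the series is binomial, and a binomial series with radius above \<open>1\<close>
  has a natural number as its exponent.
\<close>

lemma jacobi_series_beyond_branch_point: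
  assumes a: "1 + a \<notin> \<int>\<^sub>\<le>\<^sub>0" and t: "t \<noteq> 0" "norm t \<le> 1" "1 + t ^ 2 = 2 * t * x"
    and rad: "norm t < fps_conv_radius (Abs_fps (jacobi_poly a b x))"
  shows "x = - 1" "- b - 1 \<in> \<nat>"
proof -
  have cases: "x = 1 \<or> x = - 1"
  proof (rule ccontr)
    assume x: "\<not> (x = 1 \<or> x = - 1)"
    define F where "F = eval_fps (Abs_fps (jacobi_poly a b x))"
    have t1: "t \<noteq> 1" "t \<noteq> - 1" using t(3) x by (auto simp: minus_equation_iff)
    have pos: "0 < Re (1 - w)" if "norm w \<le> 1" "w \<noteq> 1" for w :: complex
    proof -
      have "(Re w)\<^sup>2 + (Im w)\<^sup>2 \<le> 1"
        using that(1) by (metis cmod_power2 norm_ge_zero power_le_one)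
      moreover have "Re w \<noteq> 1 \<or> Im w \<noteq> 0" using that(2) by (auto simp: complex_eq_iff)
      ultimately have "Re w < 1"
        by (smt (verit) one_power2 power2_eq_iff_nonneg power_mono zero_le_power2 zero_eq_power2)
      then show ?thesis by simp
    qed
    have Re: "0 < Re (1 - t)" "0 < Re (1 + t)"
      using pos[of t] pos[of "- t"] t(2) t1 by (auto simp: minus_equation_iff)
    define s where "s = (\<lambda>u::real. of_real u * t)"
    have s: "(s \<longlongrightarrow> t) (at_left 1)"
      unfolding s_def by (rule tendsto_eq_intros refl | simp)+
    have "((\<lambda>u. sqrt (norm (1 + s u ^ 2 - 2 * s u * x))) \<longlongrightarrow> sqrt (norm (1 + t ^ 2 - 2 * t * x))) (at_left 1)"
      by (intro tendsto_intros s)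
    then have R: "((\<lambda>u. jacobi_root x (s u)) \<longlongrightarrow> 0) (at_left 1)"
      by (subst tendsto_norm_zero_iff[symmetric]) (simp add: jacobi_root_def t(3))
    have F: "((\<lambda>u. F (s u)) \<longlongrightarrow> F t) (at_left 1)"
    proof -
      have "isCont F t" unfolding F_def using rad
        by (intro DERIV_isCont[OF has_field_derivative_eval_fps]) auto
      then show ?thesis using s by (rule isCont_tendsto_compose)
    qed
    have lim: "((\<lambda>u. F (s u) * jacobi_root x (s u)) \<longlongrightarrow> F t * 0) (at_left 1)"
      by (intro tendsto_intros F R)
    have lim': "((\<lambda>u. 2 powr (a + b) * (1 - s u + jacobi_root x (s u)) powr (- a) *
         (1 + s u + jacobi_root x (s u)) powr (- b)) \<longlongrightarrow>
         2 powr (a + b) * (1 - t + 0) powr (- a) * (1 + t + 0) powr (- b)) (at_left 1)"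
      using Re by (intro tendsto_intros s R tendsto_powr_complex) (auto simp: complex_nonpos_Reals_iff)
    have "\<forall>\<^sub>F u in at_left (1::real). u \<in> {0<..<1}" by (intro eventually_at_left_real) auto
    then have "\<forall>\<^sub>F u in at_left 1. 2 powr (a + b) * (1 - s u + jacobi_root x (s u)) powr (- a) *
         (1 + s u + jacobi_root x (s u)) powr (- b) = F (s u) * jacobi_root x (s u)"
    proof eventually_elim
      case (elim u)
      then have su: "norm (s u) < norm t" using t(1) by (simp add: s_def norm_mult)
      then have "jacobi_root x (s u) \<noteq> 0"
        using jacobi_radicand_notin_nonpos_Reals[OF t su] by (auto simp: jacobi_root_def)
      then show ?case
        unfolding F_def eval_jacobi_poly_series[OF a t su] by (simp add: jacobi_genfun_def)
    qed
    then have "((\<lambda>u. F (s u) * jacobi_root x (s u)) \<longlongrightarrow>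
        2 powr (a + b) * (1 - t + 0) powr (- a) * (1 + t + 0) powr (- b)) (at_left 1)"
      using lim' by (rule Lim_transform_eventually[rotated])
    with lim have "F t * 0 = 2 powr (a + b) * (1 - t + 0) powr (- a) * (1 + t + 0) powr (- b)"
      by (rule tendsto_unique[OF trivial_limit_at_left_real])
    then show False using t1 by (simp add: add_eq_0_iff)
  qed
  have t1: "norm t = 1"
  proof -
    have "x ^ 2 = 1" using cases by auto
    then have "(t - x) ^ 2 = 0" using t(3) by algebra
    then show ?thesis using cases by auto
  qed
  show "x = - 1"
  proof (rule ccontr)
    assume "x \<noteq> - 1"
    then have x: "x = 1" using cases by simp
    have "fps_conv_radius (Abs_fps (jacobi_poly a b x)) = conv_radius (\<lambda>n. - a - 1 gchoose n)"
      unfolding x jacobi_series_one[OF a] fps_conv_radius_def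
      by (subst (1 2) conv_radius_norm[symmetric]) (simp add: norm_mult norm_power)
    then have "- a - 1 \<in> \<nat>" using rad t1 by (auto simp: conv_radius_gchoose split: if_splits)
    then have "- (- a - 1) \<in> \<int>\<^sub>\<le>\<^sub>0" by (metis minus_of_nat_in_nonpos_Ints Nats_cases)
    then show False using a by (simp add: add.commute)
  qed
  with rad t1 show "- b - 1 \<in> \<nat>"
    by (auto simp: jacobi_series_minus_one[OF a] fps_conv_radius_binomial split: if_splits)
qed

section \<open>Termwise integration along the segment\<close>

text \<open>The constant coefficient is \<open>0\<close>, because division by \<open>of_nat 0\<close> yields \<open>0\<close>.\<close>

definition jacobi_antiderivative :: "complex \<Rightarrow> complex \<Rightarrow> complex \<Rightarrow> complex fps" where
  "jacobi_antiderivative a b x = Abs_fps (\<lambda>n. jacobi_poly a b x (n - 1) / of_nat n)"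

lemma fps_deriv_jacobi_antiderivative:
  "fps_deriv (jacobi_antiderivative a b x) = Abs_fps (jacobi_poly a b x)"
  by (rule fps_ext) (simp add: jacobi_antiderivative_def del: of_nat_Suc)

lemma jacobi_antiderivative_sums:
  assumes "summable (jacobi_term a b x z)"
  shows "(\<lambda>n. fps_nth (jacobi_antiderivative a b x) n * z ^ n) sums
     (z * (\<Sum>n. jacobi_term a b x z n))"
proof -
  have "fps_nth (jacobi_antiderivative a b x) (Suc n) * z ^ Suc n = z * jacobi_term a b x z n" for n
    by (simp add: jacobi_antiderivative_def jacobi_term_conv_poly del: of_nat_Suc)
  then have "(\<lambda>n. fps_nth (jacobi_antiderivative a b x) (Suc n) * z ^ Suc n) sums
      (z * (\<Sum>n. jacobi_term a b x z n))"
    using assms by (simp only:) (intro sums_mult summable_sums)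
  then show ?thesis by (subst (asm) sums_Suc_iff) (simp add: jacobi_antiderivative_def)
qed

lemma jacobi_antiderivative_conv_radius:
  assumes "summable (jacobi_term a b x z)"
  shows "norm z \<le> fps_conv_radius (jacobi_antiderivative a b x)"
  unfolding fps_conv_radius_def
  using jacobi_antiderivative_sums[OF assms] by (intro conv_radius_geI) (simp add: sums_iff)

text \<open>Differentiation does not shrink the radius of convergence, so \<open>P n * s ^ n\<close> is summable on the
  whole open disc of radius \<open>norm z\<close>, although only the integrated series is assumed to converge.\<close>

lemma jacobi_conv_radius:
  assumes "summable (jacobi_term a b x z)"
  shows "norm z \<le> fps_conv_radius (Abs_fps (jacobi_poly a b x))"
  using jacobi_antiderivative_conv_radius[OF assms] fps_conv_radius_deriv
  unfolding fps_deriv_jacobi_antiderivative[symmetric] by (rule order_trans)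

text \<open>
  The antiderivative, restricted to the segment, is differentiable except possibly at the
  endpoint \<open>z\<close>, which may lie on the circle of convergence; Abel's theorem supplies
  continuity there. Hence the closed form has to agree with the series only on the open segment.
\<close>

lemma jacobi_integral_series:
  assumes a: "1 + a \<notin> \<int>\<^sub>\<le>\<^sub>0" and z: "z \<noteq> 0"
    and sum: "summable (jacobi_term a b x z)"
    and eq: "\<And>u. 0 < u \<Longrightarrow> u < 1 \<Longrightarrow>
      eval_fps (Abs_fps (jacobi_poly a b x)) (of_real u * z) = jacobi_genfun a b x (of_real u * z)"
  shows "(jacobi_integrand a b x z has_contour_integral (\<Sum>n. jacobi_term a b x z n)) (linepath 0 z)"
proof -
  define G where "G = jacobi_antiderivative a b x"
  note G_deriv = fps_deriv_jacobi_antiderivative[of a b x, folded G_def]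
  note sums = jacobi_antiderivative_sums[OF sum, folded G_def]
  note rad = jacobi_antiderivative_conv_radius[OF sum, folded G_def]
  define g where "g = (\<lambda>u::real. eval_fps G (of_real u * z))"
  have deriv: "(g has_vector_derivative (eval_fps (Abs_fps (jacobi_poly a b x)) (of_real u * z) * z)) (at u)"
    if "0 \<le> u" "u < 1" for u
  proof -
    have "norm (of_real u * z) < norm z" using that z by (simp add: norm_mult)
    then have "ereal (norm (of_real u * z)) < fps_conv_radius G"
      using rad by (metis less_ereal.simps(1) order_less_le_trans)
    then have "(eval_fps G has_field_derivative eval_fps (fps_deriv G) (of_real u * z)) (at (of_real u * z))"
      by (intro has_field_derivative_eval_fps) auto
    moreover have "((\<lambda>u. of_real u * z) has_vector_derivative z) (at u)"
      by (auto intro!: derivative_eq_intros)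
    ultimately have "(eval_fps G \<circ> (\<lambda>u. of_real u * z) has_vector_derivative
        z * eval_fps (fps_deriv G) (of_real u * z)) (at u)"
      by (rule field_vector_diff_chain_at[rotated])
    then show ?thesis by (simp add: g_def o_def G_deriv mult.commute)
  qed
  have "continuous_on {0..1} g"
    unfolding continuous_on
  proof
    fix u :: real assume u: "u \<in> {0..1}"
    show "(g \<longlongrightarrow> g u) (at u within {0..1})"
    proof (cases "u = 1")
      case False
      then have "isCont g u"
        using u by (intro has_vector_derivative_continuous[OF deriv]) auto
      then show ?thesis unfolding isCont_def by (rule tendsto_within_subset) auto
    next
      case True
      have "((\<lambda>u::real. \<Sum>n. fps_nth G n * z ^ n * of_real u ^ n) \<longlongrightarrow>
          (\<Sum>n. fps_nth G n * z ^ n)) (at_left 1)"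
        using sums by (intro abel_limit) (simp add: sums_iff)
      then have "(g \<longlongrightarrow> g 1) (at_left 1)"
        by (simp add: g_def eval_fps_def power_mult_distrib mult_ac)
      then have "(g \<longlongrightarrow> g 1) (at 1 within {0..1})"
        by (simp add: at_within_Icc_at_left)
      then show ?thesis by (simp add: True)
    qed
  qed
  then have "((\<lambda>u. eval_fps (Abs_fps (jacobi_poly a b x)) (of_real u * z) * z) has_integral g 1 - g 0) {0..1}"
    using deriv by (intro fundamental_theorem_of_calculus_interior) auto
  also have "g 1 - g 0 = z * (\<Sum>n. jacobi_term a b x z n)"
  proof -
    have "g 0 = 0" by (simp add: g_def eval_fps_at_0 G_def jacobi_antiderivative_def)
    then show ?thesis using sums by (simp add: g_def eval_fps_def sums_iff)
  qed
  finally have "((\<lambda>u. (eval_fps (Abs_fps (jacobi_poly a b x)) (of_real u * z) * z) * (1 / z)) has_integral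
      (z * (\<Sum>n. jacobi_term a b x z n)) * (1 / z)) {0..1}"
    by (rule has_integral_mult_left)
  then have "((\<lambda>u. eval_fps (Abs_fps (jacobi_poly a b x)) (of_real u * z)) has_integral
      (\<Sum>n. jacobi_term a b x z n)) {0..1}"
    using z by simp
  then have "((\<lambda>u. jacobi_integrand a b x z (of_real u * z) * z) has_integral
      (\<Sum>n. jacobi_term a b x z n)) {0..1}"
    by (rule has_integral_spike_finite[where S = "{0, 1}", rotated 2])
      (use z in \<open>auto simp: jacobi_integrand_conv_genfun eq\<close>)
  then show ?thesis
    unfolding has_contour_integral_linepath by (simp add: linepath_def scaleR_conv_of_real)
qed

text \<open>
  For \<open>x = - 1\<close> the radicand is \<open>(1 + s)^2\<close>, and where \<open>Re (1 + s) < 0\<close> its principal root is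
  \<open>- (1 + s)\<close>, so that the base \<open>1 + s + R\<close> vanishes identically. If the open segment met the
  closed half-plane \<open>Re (1 + s) \<le> 0\<close>, its part beyond that point would consist of infinitely many
  undefined points.
\<close>

lemma segment_in_halfplane:
  assumes fin: "finite (jacobi_undefined (- 1) \<inter> closed_segment 0 z)"
    and u: "0 < u" "u < 1"
  shows "0 < Re (1 + of_real u * z)"
proof (rule ccontr)
  assume "\<not> 0 < Re (1 + of_real u * z)"
  then have uz: "u * Re z \<le> - 1" by simp
  have neg: "Re z < 0"
  proof (rule ccontr)
    assume "\<not> Re z < 0"
    then have "0 \<le> u * Re z" using u by simp
    then show False using uz by simp
  qed
  then have "z \<noteq> 0" by auto
  have "(\<lambda>v. of_real v * z) ` {u<..<1} \<subseteq> jacobi_undefined (- 1) \<inter> closed_segment 0 z"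
  proof safe
    fix v :: real assume v: "v \<in> {u<..<1}"
    have "v * Re z < u * Re z" using v neg by (intro mult_strict_right_mono_neg) auto
    then have "Re (1 + of_real v * z) < 0" using uz by simp
    then have "jacobi_root (- 1) (of_real v * z) = - (1 + of_real v * z)"
      unfolding jacobi_root_def by (intro csqrt_unique) (auto simp: power2_eq_square algebra_simps)
    then show "of_real v * z \<in> jacobi_undefined (- 1)" by (simp add: jacobi_undefined_def)
    show "of_real v * z \<in> closed_segment 0 z"
      using v u by (auto simp: closed_segment_def scaleR_conv_of_real intro!: exI[of _ v])
  qed
  then have "finite ((\<lambda>v. of_real v * z) ` {u<..<1})" using fin by (rule finite_subset)
  moreover have "inj_on (\<lambda>v. of_real v * z) {u<..<1}" using \<open>z \<noteq> 0\<close> by (auto simp: inj_on_def)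
  ultimately have "finite {u<..<1}" by (rule finite_imageD)
  then show False using u by (simp add: infinite_Ioo)
qed

lemma eval_fps_binomial_of_nat: "eval_fps (fps_binomial (of_nat k)) w = (1 + w :: complex) ^ k"
proof -
  have "fps_conv_radius (1 + fps_X :: complex fps) = \<infinity>"
    using fps_conv_radius_add[of 1 "fps_X :: complex fps"] by simp
  then have "eval_fps ((1 + fps_X) ^ k) w = eval_fps (1 + fps_X) w ^ k"
    by (intro eval_fps_power) simp
  then show ?thesis
    by (simp only: fps_binomial_of_nat) (simp add: eval_fps_add)
qed

theorem theorem4p140:
  fixes a b x z :: complex
  assumes "z \<noteq> 0"
    and "1 + a \<notin> \<int>\<^sub>\<le>\<^sub>0"
    and "summable (jacobi_term a b x z)"
    and "finite (jacobi_undefined x \<inter> closed_segment 0 z)"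
    and "jacobi_integrand a b x z contour_integrable_on linepath 0 z"
  shows "(\<Sum>n. jacobi_term a b x z n) =
         contour_integral (linepath 0 z) (jacobi_integrand a b x z)"
proof -
  obtain t where t: "t \<noteq> 0" "norm t \<le> 1" "1 + t ^ 2 = 2 * t * x"
    by (rule jacobi_branch_point)
  have rad: "norm z \<le> fps_conv_radius (Abs_fps (jacobi_poly a b x))"
    using assms(3) by (rule jacobi_conv_radius)
  have eq: "eval_fps (Abs_fps (jacobi_poly a b x)) (of_real u * z) = jacobi_genfun a b x (of_real u * z)"
    if u: "0 < u" "u < 1" for u
  proof (cases "norm z \<le> norm t")
    case True
    have "norm (of_real u * z) < norm z" using u assms(1) by (simp add: norm_mult)
    then show ?thesis using True by (intro eval_jacobi_poly_series[OF assms(2) t]) simp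
  next
    case False
    then have "norm t < fps_conv_radius (Abs_fps (jacobi_poly a b x))"
      using rad by (metis less_ereal.simps(1) not_le order_less_le_trans)
    \<comment> \<open>The series converges beyond the branch point, which leaves only the polynomial case.\<close>
    note x = jacobi_series_beyond_branch_point[OF assms(2) t this]
    then obtain k where k: "- b - 1 = of_nat k" by (auto elim: Nats_cases)
    have pos: "0 < Re (1 + of_real u * z)"
      using assms(4) u unfolding x(1) by (rule segment_in_halfplane)
    then have "1 + of_real u * z \<noteq> 0" by (metis less_irrefl zero_complex.sel(1))
    then have "jacobi_genfun a b x (of_real u * z) = (1 + of_real u * z) ^ k"
      unfolding x(1) jacobi_genfun_minus_one[OF pos] k by (simp add: powr_nat)
    moreover have "eval_fps (fps_binomial (of_nat k)) (of_real u * z) = (1 + of_real u * z) ^ k"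
      by (rule eval_fps_binomial_of_nat)
    ultimately show ?thesis
      unfolding x(1) jacobi_series_minus_one[OF assms(2)] k by (simp only:)
  qed
  show ?thesis
    by (rule contour_integral_unique[OF jacobi_integral_series[OF assms(2,1,3) eq], symmetric])
qed

end
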